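(* Let $\mathcal{I} = (\mathcal{F}_i)_{i=1}^n$ be an instance of the hiring problem and, for each $\pi\in S_n$, let $\mathrm{OPTOn}^\pi$ be an optimal (expected-value-maximizing) stopping rule for ordering $\pi$. There exists a TIF family of stopping rules $\{\mathrm{OnTIF}^\pi\}_{\pi\in S_n}$ for $\mathcal{I}$ such that \[ \mathbb{E}[\mathrm{OnTIF}^\pi] \ge \tfrac12\,\mathbb{E}[\mathrm{OPTOn}^\pi]\quad\text{for all }\pi\in S_n. \] Moreover the inequality is tight: for every $c>1/2$ there is an instance and an ordering $\pi$ such that every TIF family $\{\mathrm{ALG}^\sigma\}_{\sigma\in S_n}$ satisfies $\mathbb{E}[\mathrm{ALG}^\pi] < c\,\mathbb{E}[\mathrm{OPTOn}^\pi]$.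
   Context: Hiring problem: $n$ candidates; candidate $i$ has a nonnegative random value $X_i\sim\mathcal{F}_i$, the $X_i$ independent, each $\mathcal{F}_i$ discrete; $f_i(x)=\Pr[X_i=x]$, $\mathcal{S}=\bigcup_i\{x:f_i(x)>0\}$. For a permutation $\pi$ of $[n]$ (arrival ordering), at step $t$ candidate $\pi(t)$ arrives, $X_{\pi(t)}$ is revealed, and the decision maker either hires $\pi(t)$ (and stops) or rejects it irrevocably. A stopping rule for ordering $\pi$ is a possibly randomized procedure knowing $n$, the $\mathcal{F}_i$, $\pi$, deciding at step $t$ using only $X_{\pi(1)},\dots,X_{\pi(t)}$ (and own randomness), hiring at most one candidate; its name also denotes the hired value ($0$ if none). A family $\{\mathrm{ALG}^\pi\}_{\pi\in S_n}$ (one stopping rule per ordering) is TIF if there is $p:[n]\times\mathcal{S}\to[0,1]$ with $\Pr[\mathrm{ALG}^\pi\text{ hires } i\mid X_i=x]=p(i,x)$ for all $i\in[n]$, $x\in\mathcal{S}$, $\pi\in S_n$. *)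

theory Defs
  imports "HOL-Probability.Probability"
begin

text \<open>
  An instance is a number \<open>n\<close> of candidates \<open>1, \<dots>, n\<close> together with distributions
  \<open>F 1, \<dots>, F n\<close>; a \<open>pmf\<close> is exactly a discrete distribution, with finite or countable
  support. Expected values may be infinite.
\<close>

definition hiring_instance :: "nat \<Rightarrow> (nat \<Rightarrow> real pmf) \<Rightarrow> bool" where
  "hiring_instance n F \<longleftrightarrow> (\<forall>i\<in>{1..n}. set_pmf (F i) \<subseteq> {0..})"

definition value_support :: "nat \<Rightarrow> (nat \<Rightarrow> real pmf) \<Rightarrow> real set" where
  "value_support n F = (\<Union>i\<in>{1..n}. {x. pmf (F i) x > 0})"

text \<open>
  A randomized stopping rule maps the list of values revealed so far (its length is the
  current step) and a private memory to a random decision (\<open>True\<close> means hire) and a new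
  memory. The memory lets the rule correlate its own randomness across steps, e.g. by
  drawing a random seed at the first step. Since every draw is discrete, only countably
  many memory contents are ever reached, so \<open>nat\<close> suffices. What the rule knows in
  advance (\<open>n\<close>, \<open>F\<close>, the ordering) is no argument: a rule is chosen per instance
  and per ordering.
\<close>

type_synonym stopping_rule = "real list \<Rightarrow> nat \<Rightarrow> (bool \<times> nat) pmf"

text \<open>
  The random hire (\<open>None\<close> if nobody is hired) for a fixed value profile \<open>X\<close>, when the
  candidates \<open>seen\<close> have been rejected, the candidates in the last list argument are still
  to arrive in that order, and \<open>m\<close> is the current memory.
\<close>

fun hire_from :: "stopping_rule \<Rightarrow> (nat \<Rightarrow> real) \<Rightarrow> nat list \<Rightarrow> nat \<Rightarrow> nat list \<Rightarrow> nat option pmf"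
  where
  "hire_from A X seen m [] = return_pmf None"
| "hire_from A X seen m (i # rest) =
     bind_pmf (A (map X (seen @ [i])) m)
       (\<lambda>(hire, m'). if hire then return_pmf (Some i)
                     else hire_from A X (seen @ [i]) m' rest)"

text \<open>Joint law of the independent values and the hired candidate under ordering \<open>\<pi>\<close>.\<close>

definition outcome ::
    "nat \<Rightarrow> (nat \<Rightarrow> real pmf) \<Rightarrow> (nat \<Rightarrow> nat) \<Rightarrow> stopping_rule \<Rightarrow> ((nat \<Rightarrow> real) \<times> nat option) pmf"
  where
  "outcome n F \<pi> A =
     bind_pmf (Pi_pmf {1..n} 0 F)
       (\<lambda>X. map_pmf (\<lambda>h. (X, h)) (hire_from A X [] 0 (map \<pi> [1..<Suc n])))"

definition hired_value :: "(nat \<Rightarrow> real) \<times> nat option \<Rightarrow> real" where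
  "hired_value = (\<lambda>(X, h). case h of None \<Rightarrow> 0 | Some i \<Rightarrow> X i)"

definition expected_value ::
    "nat \<Rightarrow> (nat \<Rightarrow> real pmf) \<Rightarrow> (nat \<Rightarrow> nat) \<Rightarrow> stopping_rule \<Rightarrow> ennreal" where
  "expected_value n F \<pi> A = (\<integral>\<^sup>+ \<omega>. ennreal (hired_value \<omega>) \<partial>measure_pmf (outcome n F \<pi> A))"

definition optimal_rule ::
    "nat \<Rightarrow> (nat \<Rightarrow> real pmf) \<Rightarrow> (nat \<Rightarrow> nat) \<Rightarrow> stopping_rule \<Rightarrow> bool" where
  "optimal_rule n F \<pi> A \<longleftrightarrow> (\<forall>B. expected_value n F \<pi> B \<le> expected_value n F \<pi> A)"

text \<open>
  The condition is imposed where the conditional probability is defined, i.e. where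
  \<open>X\<^sub>i = x\<close> has positive probability; for other \<open>x\<close> in the common support
  \<open>p i x\<close> is unconstrained.
\<close>

definition TIF ::
    "nat \<Rightarrow> (nat \<Rightarrow> real pmf) \<Rightarrow> ((nat \<Rightarrow> nat) \<Rightarrow> stopping_rule) \<Rightarrow> bool" where
  "TIF n F ALG \<longleftrightarrow>
     (\<exists>p :: nat \<Rightarrow> real \<Rightarrow> real.
        (\<forall>i\<in>{1..n}. \<forall>x\<in>value_support n F. p i x \<in> {0..1}) \<and>
        (\<forall>i\<in>{1..n}. \<forall>x\<in>value_support n F. \<forall>\<pi>. \<pi> permutes {1..n} \<longrightarrow> pmf (F i) x > 0 \<longrightarrow>
           \<P>(\<omega> in measure_pmf (outcome n F \<pi> (ALG \<pi>)). snd \<omega> = Some i \<bar> fst \<omega> i = x) = p i x))"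

end

theory Submission
  imports Defs
begin

text \<open>
  The expected value of a stopping rule depends only on the probabilities of hiring \<open>i\<close> while
  \<open>X\<^sub>i = x\<close>. Choose an ordering \<open>\<rho>\<close> whose optimal value is the largest and let \<open>q i x\<close> be the
  probability that its optimal rule hires \<open>i\<close> given \<open>X\<^sub>i = x\<close>, with mean \<open>Q i\<close>, so that
  \<open>\<Sum>i. Q i \<le> 1\<close>. Under an arbitrary ordering \<open>\<pi>\<close>, hire the candidate of step \<open>t\<close> with probability
  \<open>q (\<pi> t) x / (2 - (\<Sum>s<t. Q (\<pi> s)))\<close>, using fresh coins. Step \<open>t\<close> is reached with probability
  \<open>1 - (\<Sum>s<t. Q (\<pi> s)) / 2\<close>, so every \<open>q i x\<close> is halved exactly, whatever \<open>\<pi>\<close> is.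

  For tightness take \<open>X\<^sub>1 = 1\<close> and \<open>X\<^sub>2 = 1/\<epsilon>\<close> with probability \<open>\<epsilon>\<close>, else \<open>0\<close>. In the order
  \<open>1, 2\<close> no rule gets more than \<open>1\<close>, and a TIF family has the same value in every order; but in
  the order \<open>2, 1\<close> the maximum, worth \<open>2 - \<epsilon>\<close>, can be hired.
\<close>

section \<open>Expected value and TIF condition through joint probabilities of hire and
  value\<close>

definition joint_prob :: "((nat \<Rightarrow> real) \<times> nat option) pmf \<Rightarrow> nat \<Rightarrow> real \<Rightarrow> real" where
  "joint_prob M i x = measure_pmf.prob M {\<omega>. snd \<omega> = Some i \<and> fst \<omega> i = x}"

lemma joint_prob_nonneg [simp]: "0 \<le> joint_prob M i x"
  by (simp add: joint_prob_def)

text \<open>The integrand sees \<open>\<omega>\<close> only through the value of \<open>i\<close>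
  and the event that \<open>i\<close> is hired, a pair with a discrete law. The weight stays general
  because \<open>w = ennreal\<close> yields expected values and \<open>w = 1\<close> yields hiring
  probabilities.\<close>

lemma nn_integral_hired_weight:
  fixes w :: "real \<Rightarrow> ennreal"
  shows "(\<integral>\<^sup>+\<omega>. w (fst \<omega> i) * indicator {\<omega>. snd \<omega> = Some i} \<omega> \<partial>measure_pmf M) =
         (\<integral>\<^sup>+x. w x * ennreal (joint_prob M i x) \<partial>count_space UNIV)"
proof -
  define N where "N = map_pmf (\<lambda>\<omega>. (fst \<omega> i, snd \<omega> = Some i)) M"
  have N: "pmf N (x, True) = joint_prob M i x" for x
    unfolding N_def pmf_map joint_prob_def by (rule arg_cong[where f = "measure_pmf.prob M"]) auto
  have "(\<integral>\<^sup>+\<omega>. w (fst \<omega> i) * indicator {\<omega>. snd \<omega> = Some i} \<omega> \<partial>measure_pmf M) =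
        (\<integral>\<^sup>+y. w (fst y) * of_bool (snd y) \<partial>measure_pmf N)"
    by (auto simp: N_def indicator_def intro!: nn_integral_cong)
  also have "\<dots> = (\<integral>\<^sup>+y. ennreal (pmf N y) * (w (fst y) * of_bool (snd y)) \<partial>count_space UNIV)"
    by (rule nn_integral_measure_pmf)
  also have "\<dots> = (\<integral>\<^sup>+x. \<integral>\<^sup>+b. ennreal (pmf N (x, b)) * (w x * of_bool b)
                     \<partial>count_space UNIV \<partial>count_space UNIV)"
    by (subst nn_integral_fst_count_space[symmetric]) simp
  also have "\<dots> = (\<integral>\<^sup>+x. w x * ennreal (joint_prob M i x) \<partial>count_space UNIV)"
    by (intro nn_integral_cong) (simp add: nn_integral_count_space_finite UNIV_bool N mult.commute)
  finally show ?thesis .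
qed

lemma set_hire_from: "set_pmf (hire_from A X seen m l) \<subseteq> insert None (Some ` set l)"
proof (induction l arbitrary: seen m)
  case (Cons i rest)
  show ?case
  proof
    fix h assume "h \<in> set_pmf (hire_from A X seen m (i # rest))"
    then obtain d m' where
      "h \<in> set_pmf (if d then return_pmf (Some i) else hire_from A X (seen @ [i]) m' rest)"
      by auto
    then show "h \<in> insert None (Some ` set (i # rest))"
      using Cons.IH[of "seen @ [i]" m'] by (cases d) auto
  qed
qed simp

lemma set_ordering:
  assumes "\<pi> permutes {1..n}"
  shows "set (map \<pi> [1..<Suc n]) = {1..n}"
  using permutes_image[OF assms] by (simp add: atLeastLessThanSuc_atLeastAtMost del: upt_Suc)

text \<open>At most one candidate is hired, so the hired value splits into one term per candidate
  and linearity applies. As \<open>\<pi>\<close> is a permutation, the arriving candidates are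
  exactly those summed over.\<close>

lemma expected_value_joint_prob:
  assumes "\<pi> permutes {1..n}"
  shows "expected_value n F \<pi> A =
    (\<Sum>i\<in>{1..n}. \<integral>\<^sup>+x. ennreal x * ennreal (joint_prob (outcome n F \<pi> A) i x) \<partial>count_space UNIV)"
proof -
  let ?M = "outcome n F \<pi> A"
  have supp: "snd \<omega> \<in> insert None (Some ` {1..n})" if \<omega>: "\<omega> \<in> set_pmf ?M" for \<omega>
  proof -
    obtain X where "snd \<omega> \<in> set_pmf (hire_from A X [] 0 (map \<pi> [1..<Suc n]))"
      using \<omega> by (auto simp: outcome_def simp del: upt_Suc)
    then show ?thesis
      using set_hire_from set_ordering[OF assms] by (metis subsetD)
  qed
  have "expected_value n F \<pi> A =
      (\<integral>\<^sup>+\<omega>. (\<Sum>i\<in>{1..n}. ennreal (fst \<omega> i) * indicator {\<omega>. snd \<omega> = Some i} \<omega>) \<partial>measure_pmf ?M)"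
    unfolding expected_value_def
  proof (intro nn_integral_cong_AE AE_pmfI)
    fix \<omega> assume "\<omega> \<in> set_pmf ?M"
    then have "snd \<omega> \<in> insert None (Some ` {1..n})"
      by (rule supp)
    then consider "snd \<omega> = None" | i where "i \<in> {1..n}" "snd \<omega> = Some i"
      by (elim insertE imageE) auto
    then show "ennreal (hired_value \<omega>) =
        (\<Sum>i\<in>{1..n}. ennreal (fst \<omega> i) * indicator {\<omega>. snd \<omega> = Some i} \<omega>)"
    proof cases
      case 1
      then show ?thesis by (auto simp: hired_value_def split: prod.splits)
    next
      case (2 i)
      then have "(\<Sum>j\<in>{1..n}. ennreal (fst \<omega> j) * indicator {\<omega>. snd \<omega> = Some j} \<omega>) =
          (\<Sum>j\<in>{1..n}. if j = i then ennreal (fst \<omega> i) else 0)"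
        by (intro sum.cong) (auto simp: indicator_def)
      with 2 show ?thesis by (auto simp: hired_value_def split: prod.splits)
    qed
  qed
  also have "\<dots> = (\<Sum>i\<in>{1..n}. \<integral>\<^sup>+\<omega>. ennreal (fst \<omega> i) * indicator {\<omega>. snd \<omega> = Some i} \<omega> \<partial>measure_pmf ?M)"
    by (rule nn_integral_sum) simp
  finally show ?thesis
    by (simp only: nn_integral_hired_weight[where w = ennreal])
qed

lemma prob_value_outcome:
  assumes "i \<in> {1..n}"
  shows "measure_pmf.prob (outcome n F \<pi> A) {\<omega>. fst \<omega> i = x} = pmf (F i) x"
proof -
  have "map_pmf (\<lambda>\<omega>. fst \<omega> i) (outcome n F \<pi> A) = map_pmf (\<lambda>X. X i) (Pi_pmf {1..n} 0 F)"
    by (simp add: outcome_def map_bind_pmf pmf.map_comp o_def) (simp add: map_pmf_def)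
  also have "\<dots> = F i"
    using assms by (simp add: Pi_pmf_component)
  finally have "pmf (F i) x = pmf (map_pmf (\<lambda>\<omega>. fst \<omega> i) (outcome n F \<pi> A)) x"
    by simp
  then show ?thesis
    by (simp add: pmf_map vimage_def)
qed

text \<open>Makes joint probabilities vanish off the support of \<open>F i\<close>, so nothing is
  lost by dividing by \<open>pmf (F i) x\<close>.\<close>

lemma joint_prob_le:
  assumes "i \<in> {1..n}"
  shows "joint_prob (outcome n F \<pi> A) i x \<le> pmf (F i) x"
  unfolding joint_prob_def prob_value_outcome[OF assms, of F \<pi> A x, symmetric]
  by (rule measure_pmf.finite_measure_mono) auto

lemma cond_prob_outcome:
  assumes "i \<in> {1..n}"
  shows "\<P>(\<omega> in measure_pmf (outcome n F \<pi> A). snd \<omega> = Some i \<bar> fst \<omega> i = x) =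
         joint_prob (outcome n F \<pi> A) i x / pmf (F i) x"
  by (simp add: cond_prob_def joint_prob_def prob_value_outcome[OF assms])

text \<open>The common \<open>p\<close> fixes all joint probabilities on the support, and off the
  support they are zero; the expected value is a function of them alone.\<close>

lemma TIF_expected_value_eq:
  assumes "TIF n F ALG" "\<pi> permutes {1..n}" "\<sigma> permutes {1..n}"
  shows "expected_value n F \<pi> (ALG \<pi>) = expected_value n F \<sigma> (ALG \<sigma>)"
proof -
  have "joint_prob (outcome n F \<pi> (ALG \<pi>)) i x = joint_prob (outcome n F \<sigma> (ALG \<sigma>)) i x"
    if i: "i \<in> {1..n}" for i x
  proof (cases "pmf (F i) x > 0")
    case True
    then have "x \<in> value_support n F"
      using i by (auto simp: value_support_def)
    with True assms i
    have "joint_prob (outcome n F \<pi> (ALG \<pi>)) i x / pmf (F i) x =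
          joint_prob (outcome n F \<sigma> (ALG \<sigma>)) i x / pmf (F i) x"
      unfolding TIF_def cond_prob_outcome[OF i, symmetric] by metis
    with True show ?thesis by simp
  next
    case False
    then have "pmf (F i) x = 0"
      using pmf_nonneg[of "F i" x] by linarith
    then show ?thesis
      using joint_prob_le[OF i, of F _ _ x] joint_prob_nonneg by (metis order_antisym)
  qed
  then show ?thesis
    unfolding expected_value_joint_prob[OF assms(2)] expected_value_joint_prob[OF assms(3)]
    by (intro sum.cong nn_integral_cong refl) simp
qed

section \<open>Rules that toss a fresh coin at every step\<close>

lemma joint_prob_outcome:
  "joint_prob (outcome n F \<pi> A) i x =
    measure_pmf.expectation (Pi_pmf {1..n} 0 F)
      (\<lambda>X. of_bool (X i = x) * pmf (hire_from A X [] 0 (map \<pi> [1..<Suc n])) (Some i))"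
proof -
  have *: "pmf (map_pmf (\<lambda>h. h = Some i \<and> X i = x) H) True = of_bool (X i = x) * pmf H (Some i)"
    for X :: "nat \<Rightarrow> real" and H
    by (cases "X i = x") (simp_all add: pmf_map vimage_def measure_pmf_single)
  have "joint_prob (outcome n F \<pi> A) i x =
      pmf (map_pmf (\<lambda>\<omega>. snd \<omega> = Some i \<and> fst \<omega> i = x) (outcome n F \<pi> A)) True"
    by (simp add: joint_prob_def pmf_map vimage_def)
  also have "\<dots> = measure_pmf.expectation (Pi_pmf {1..n} 0 F)
      (\<lambda>X. pmf (map_pmf (\<lambda>h. h = Some i \<and> X i = x)
                  (hire_from A X [] 0 (map \<pi> [1..<Suc n]))) True)"
    by (simp only: outcome_def map_bind_pmf pmf_bind pmf.map_comp o_def fst_conv snd_conv)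
  finally show ?thesis
    unfolding * .
qed

text \<open>The memory is reset to 0, so the coins of different steps are independent. The list
  includes the current value, so its length is the current step.\<close>

definition coin_rule :: "(nat \<Rightarrow> real \<Rightarrow> real) \<Rightarrow> stopping_rule" where
  "coin_rule g xs m = map_pmf (\<lambda>b. (b, 0)) (bernoulli_pmf (g (length xs) (last xs)))"

lemma pmf_hire_from_coin_rule_Cons:
  assumes "g (Suc (length seen)) (X i) \<in> {0..1}"
  shows "pmf (hire_from (coin_rule g) X seen m (i # rest)) h =
    g (Suc (length seen)) (X i) * of_bool (h = Some i) +
    (1 - g (Suc (length seen)) (X i)) * pmf (hire_from (coin_rule g) X (seen @ [i]) 0 rest) h"
proof -
  have "coin_rule g (map X (seen @ [i])) m =
      map_pmf (\<lambda>b. (b, 0)) (bernoulli_pmf (g (Suc (length seen)) (X i)))"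
    by (simp add: coin_rule_def)
  with assms show ?thesis
    by (auto simp: bind_map_pmf pmf_bind)
qed

text \<open>For fixed values, \<open>\<pi> t\<close> is hired iff all earlier coins reject and its
  own accepts, since it arrives only once. The start \<open>s\<close> is general for the sake of the
  induction; the application has \<open>s = 1\<close>.\<close>

lemma pmf_hire_from_coin_rule:
  assumes \<pi>: "inj_on \<pi> {1..n}"
    and g: "\<And>t. t \<in> {1..n} \<Longrightarrow> g t (X (\<pi> t)) \<in> {0..1}"
    and "1 \<le> s" "s \<le> t" "t \<le> n"
  shows "pmf (hire_from (coin_rule g) X (map \<pi> [1..<s]) m (map \<pi> [s..<Suc n])) (Some (\<pi> t)) =
         (\<Prod>r\<in>{s..<t}. 1 - g r (X (\<pi> r))) * g t (X (\<pi> t))"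
  using \<open>s \<le> t\<close> \<open>1 \<le> s\<close>
proof (induction s arbitrary: m rule: inc_induct)
  case base
  \<comment> \<open>By injectivity \<open>\<pi> t\<close> does not arrive again, so once rejected it
    cannot be hired.\<close>
  have rest: "pmf (hire_from (coin_rule g) X seen 0 (map \<pi> [Suc t..<Suc n])) (Some (\<pi> t)) = 0" for seen
  proof -
    have "\<pi> t \<notin> set (map \<pi> [Suc t..<Suc n])"
    proof
      assume "\<pi> t \<in> set (map \<pi> [Suc t..<Suc n])"
      then obtain r where "r \<in> {Suc t..<Suc n}" "\<pi> t = \<pi> r"
        by (metis imageE set_map set_upt)
      with inj_onD[OF \<pi>, of t r] base \<open>t \<le> n\<close> show False
        by simp
    qed
    then show ?thesis
      using set_hire_from[of "coin_rule g" X seen 0 "map \<pi> [Suc t..<Suc n]"]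
      by (auto simp: set_pmf_iff)
  qed
  have "[t..<Suc n] = t # [Suc t..<Suc n]"
    using \<open>t \<le> n\<close> by (simp add: upt_conv_Cons)
  with base rest g[of t] \<open>t \<le> n\<close> show ?case
    by (simp add: pmf_hire_from_coin_rule_Cons del: upt_Suc hire_from.simps)
next
  case (step s)
  have *: "[s..<Suc n] = s # [Suc s..<Suc n]" "{s..<t} = insert s {Suc s..<t}"
    using step \<open>t \<le> n\<close> by (auto simp: upt_conv_Cons simp del: upt_Suc)
  have seen: "map \<pi> [1..<s] @ [\<pi> s] = map \<pi> [1..<Suc s]"
    using step by simp
  \<comment> \<open>A hire at step \<open>s\<close> is of another candidate, so only the rejecting
    branch contributes.\<close>
  have "\<pi> s \<noteq> \<pi> t"
    using inj_onD[OF \<pi>, of s t] step.prems step.hyps \<open>t \<le> n\<close> by auto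
  with * step g[of s] \<open>t \<le> n\<close> seen show ?case
    by (simp add: pmf_hire_from_coin_rule_Cons del: upt_Suc upt.simps hire_from.simps)
qed

lemma expectation_prod_ordering:
  fixes h :: "nat \<Rightarrow> real \<Rightarrow> real"
  assumes \<pi>: "\<pi> permutes {1..n}"
    and h: "\<And>t x. t \<in> {1..n} \<Longrightarrow> x \<in> set_pmf (F (\<pi> t)) \<Longrightarrow> h t x \<in> {0..1}"
  shows "measure_pmf.expectation (Pi_pmf {1..n} d F) (\<lambda>X. \<Prod>t\<in>{1..n}. h t (X (\<pi> t))) =
         (\<Prod>t\<in>{1..n}. measure_pmf.expectation (F (\<pi> t)) (h t))"
proof -
  note inv = permutes_inverses[OF \<pi>]
  \<comment> \<open>Independence is available for products over candidates, while the claim is a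
    product over steps; reindexing along \<open>\<pi>\<close> connects them.\<close>
  have perm: "(\<Prod>i\<in>{1..n}. k (inv \<pi> i) i) = (\<Prod>t\<in>{1..n}. k t (\<pi> t))" for k :: "nat \<Rightarrow> nat \<Rightarrow> real"
    using prod.permute[OF \<pi>, of "\<lambda>i. k (inv \<pi> i) i"] by (simp add: o_def inv)
  have h': "h (inv \<pi> i) x \<in> {0..1}" if "i \<in> {1..n}" "x \<in> set_pmf (F i)" for i x
    using h[of "inv \<pi> i" x] that permutes_in_image[OF permutes_inv[OF \<pi>]] by (simp add: inv)
  have "measure_pmf.expectation (Pi_pmf {1..n} d F) (\<lambda>X. \<Prod>i\<in>{1..n}. h (inv \<pi> i) (X i)) =
        (\<Prod>i\<in>{1..n}. measure_pmf.expectation (F i) (h (inv \<pi> i)))"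
    using h' by (intro expectation_prod_Pi_pmf measure_pmf.integrable_const_bound[where B = 1])
      (auto intro!: AE_pmfI)
  then show ?thesis
    by (simp only: perm[of "\<lambda>t i. h t (_ i)"] perm[of "\<lambda>t i. measure_pmf.expectation (F i) (h t)"])
qed

section \<open>Halving all hiring probabilities under any ordering\<close>

lemma halving_rule:
  fixes n :: nat and F :: "nat \<Rightarrow> real pmf"
  assumes \<pi>: "\<pi> permutes {1..n}"
  shows "\<exists>A. \<forall>i\<in>{1..n}. \<forall>x. joint_prob (outcome n F \<pi> A) i x = joint_prob (outcome n F \<rho> B) i x / 2"
proof -
  define M where "M = outcome n F \<rho> B"
  \<comment> \<open>Off the support of \<open>F i\<close> division by zero gives 0, so the bounds
    and the product formula below hold for every \<open>x\<close>.\<close>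
  define q where "q = (\<lambda>i x. joint_prob M i x / pmf (F i) x)"
  define Q where "Q = (\<lambda>i. measure_pmf.expectation (F i) (q i))"
  \<comment> \<open>\<open>c t\<close> is twice the probability that step \<open>t\<close> is
    reached; the sum covers only the steps before \<open>t\<close>.\<close>
  define c where "c = (\<lambda>t. 2 - (\<Sum>s\<in>{1..<t}. Q (\<pi> s)))"
  define g where "g = (\<lambda>t x. q (\<pi> t) x / c t)"
  have q01: "q i x \<in> {0..1}" if "i \<in> {1..n}" for i x
    using joint_prob_le[OF that, of F \<rho> B x]
    by (auto simp: q_def M_def divide_le_eq_1 pmf_nonneg less_le)
  have fq: "pmf (F i) x * q i x = joint_prob M i x" if "i \<in> {1..n}" for i x
    using joint_prob_le[OF that, of F \<rho> B x] joint_prob_nonneg[of M i x]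
    by (auto simp: q_def M_def intro: antisym)
  have int_q: "integrable (measure_pmf (F i)) (q i)" if "i \<in> {1..n}" for i
    using q01[OF that] by (intro measure_pmf.integrable_const_bound[where B = 1]) (auto intro!: AE_pmfI)
  have Q0: "Q i \<ge> 0" if "i \<in> {1..n}" for i
    using q01[OF that] by (auto simp: Q_def intro!: integral_nonneg_AE AE_pmfI)
  \<comment> \<open>Law of total probability: averaging the conditional hiring probabilities gives
    the unconditional one.\<close>
  have Q: "Q i = measure_pmf.prob M {\<omega>. snd \<omega> = Some i}" if i: "i \<in> {1..n}" for i
  proof -
    have "ennreal (Q i) = (\<integral>\<^sup>+x. ennreal (q i x) \<partial>measure_pmf (F i))"
      using q01[OF i] int_q[OF i] by (simp add: Q_def nn_integral_eq_integral)
    also have "\<dots> = (\<integral>\<^sup>+x. 1 * ennreal (joint_prob M i x) \<partial>count_space UNIV)"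
      using q01[OF i] by (simp add: nn_integral_measure_pmf fq[OF i, symmetric] ennreal_mult)
    also have "\<dots> = emeasure (measure_pmf M) {\<omega>. snd \<omega> = Some i}"
      by (subst nn_integral_hired_weight[symmetric]) simp
    finally show ?thesis
      using Q0[OF i] by (simp add: measure_pmf.emeasure_eq_measure)
  qed
  \<comment> \<open>Hiring different candidates are disjoint events. The resulting bound 1 gives
    \<open>c t \<ge> 1\<close>, which makes \<open>g t x\<close> a probability.\<close>
  have "(\<Sum>i\<in>{1..n}. Q i) = measure_pmf.prob M (\<Union>i\<in>{1..n}. {\<omega>. snd \<omega> = Some i})"
    by (subst measure_pmf.finite_measure_finite_Union) (auto simp: Q disjoint_family_on_def)
  then have "(\<Sum>i\<in>{1..n}. Q i) \<le> 1"
    by simp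
  then have Q1: "(\<Sum>t\<in>{1..n}. Q (\<pi> t)) \<le> 1"
    using sum.permute[OF \<pi>, of Q] by (simp add: o_def)
  have in_n: "\<pi> t \<in> {1..n} \<longleftrightarrow> t \<in> {1..n}" for t
    using permutes_in_image[OF \<pi>] .
  have c1: "1 \<le> c t" if "t \<le> Suc n" for t
  proof -
    have "(\<Sum>s\<in>{1..<t}. Q (\<pi> s)) \<le> (\<Sum>t\<in>{1..n}. Q (\<pi> t))"
      using that in_n Q0 by (intro sum_mono2) auto
    with Q1 show ?thesis by (simp add: c_def)
  qed
  have c_Suc: "c (Suc t) = c t - Q (\<pi> t)" if "1 \<le> t" for t
    using that by (simp add: c_def)
  have g01: "g t x \<in> {0..1}" if "t \<in> {1..n}" for t x
  proof -
    have "1 \<le> c t" "q (\<pi> t) x \<in> {0..1}"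
      using that in_n c1[of t] q01[of "\<pi> t" x] by auto
    then show ?thesis by (auto simp: g_def divide_le_eq_1)
  qed
  \<comment> \<open>The mean rejection probability is a ratio of successive values of
    \<open>c\<close>, so the product over steps telescopes.\<close>
  have G: "measure_pmf.expectation (F (\<pi> t)) (\<lambda>x. 1 - g t x) = c (Suc t) / c t" if "t \<in> {1..n}" for t
  proof -
    have "measure_pmf.expectation (F (\<pi> t)) (\<lambda>x. 1 - g t x) = 1 - Q (\<pi> t) / c t"
      using int_q[of "\<pi> t"] that in_n by (simp add: g_def Q_def)
    with c1[of t] that show ?thesis by (simp add: c_Suc field_simps)
  qed
  \<comment> \<open>The empty sum gives \<open>c 1 = 2\<close>, the source of the factor one
    half.\<close>
  have telescope: "(\<Prod>r\<in>{1..<t}. c (Suc r) / c r) = c t / 2" if "1 \<le> t" "t \<le> n" for t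
    using that
  proof (induction t rule: dec_induct)
    case (step t)
    then have "(\<Prod>r\<in>{1..<Suc t}. c (Suc r) / c r) = c t / 2 * (c (Suc t) / c t)"
      by (subst step.IH[symmetric]) auto
    with c1[of t] step show ?case by simp
  qed (simp add: c_def)
  have "joint_prob (outcome n F \<pi> (coin_rule g)) (\<pi> t) x = joint_prob M (\<pi> t) x / 2"
    if t: "t \<in> {1..n}" for t x
  proof -
    \<comment> \<open>One factor per step: rejection before \<open>t\<close>, acceptance of the
      value \<open>x\<close> at \<open>t\<close>, and 1 afterwards. Each depends on one value only,
      so the expectation factorizes.\<close>
    define h where "h = (\<lambda>r y. if r < t then 1 - g r y else if r = t then of_bool (y = x) * g t y else 1)"
    have split: "{1..n} = {1..<t} \<union> {t} \<union> {t<..n}"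
      using t by auto
    have prod_split: "(\<Prod>r\<in>{1..n}. k r) = (\<Prod>r\<in>{1..<t}. k r) * k t * (\<Prod>r\<in>{t<..n}. k r)"
      for k :: "nat \<Rightarrow> real"
      unfolding split by (subst prod.union_disjoint; auto)+
    have "joint_prob (outcome n F \<pi> (coin_rule g)) (\<pi> t) x =
        measure_pmf.expectation (Pi_pmf {1..n} 0 F) (\<lambda>X. \<Prod>r\<in>{1..n}. h r (X (\<pi> r)))"
      unfolding joint_prob_outcome
    proof (intro Bochner_Integration.integral_cong refl)
      fix X :: "nat \<Rightarrow> real"
      have "pmf (hire_from (coin_rule g) X [] 0 (map \<pi> [1..<Suc n])) (Some (\<pi> t)) =
          (\<Prod>r\<in>{1..<t}. 1 - g r (X (\<pi> r))) * g t (X (\<pi> t))"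
        using pmf_hire_from_coin_rule[of \<pi> n g X 1 t 0] permutes_inj_on[OF \<pi>] g01 t by simp
      then show "of_bool (X (\<pi> t) = x) *
            pmf (hire_from (coin_rule g) X [] 0 (map \<pi> [1..<Suc n])) (Some (\<pi> t)) =
          (\<Prod>r\<in>{1..n}. h r (X (\<pi> r)))"
        unfolding prod_split by (simp add: h_def)
    qed
    also have "\<dots> = (\<Prod>r\<in>{1..n}. measure_pmf.expectation (F (\<pi> r)) (h r))"
      using g01 by (intro expectation_prod_ordering[OF \<pi>]) (auto simp: h_def)
    also have "\<dots> = c t / 2 * measure_pmf.expectation (F (\<pi> t)) (\<lambda>y. of_bool (y = x) * g t y)"
      unfolding prod_split using t telescope[of t] G by (simp add: h_def)
    also have "measure_pmf.expectation (F (\<pi> t)) (\<lambda>y. of_bool (y = x) * g t y) =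
        pmf (F (\<pi> t)) x * g t x"
      by (subst integral_measure_pmf_real[where A = "{x}"]) auto
    also have "c t / 2 * (pmf (F (\<pi> t)) x * g t x) = joint_prob M (\<pi> t) x / 2"
      using c1[of t] t in_n by (simp add: g_def fq[symmetric])
    finally show ?thesis .
  qed
  then have "\<forall>i\<in>{1..n}. \<forall>x. joint_prob (outcome n F \<pi> (coin_rule g)) i x = joint_prob M i x / 2"
    using permutes_surj[OF \<pi>] in_n by (metis surjD)
  then show ?thesis
    unfolding M_def by blast
qed

text \<open>Halving the same joint probabilities for every ordering makes the family TIF with value
  \<open>V \<rho> / 2\<close> throughout, which suffices because \<open>V \<rho>\<close> is
  maximal.\<close>

lemma half_TIF_family:
  fixes n :: nat and F :: "nat \<Rightarrow> real pmf" and OPTOn :: "(nat \<Rightarrow> nat) \<Rightarrow> stopping_rule"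
  shows "\<exists>OnTIF. TIF n F OnTIF \<and>
           (\<forall>\<pi>. \<pi> permutes {1..n} \<longrightarrow>
             expected_value n F \<pi> (OnTIF \<pi>) \<ge> 1 / 2 * expected_value n F \<pi> (OPTOn \<pi>))"
proof -
  define V where "V = (\<lambda>\<pi>. expected_value n F \<pi> (OPTOn \<pi>))"
  have fin: "finite (V ` {\<pi>. \<pi> permutes {1..n}})" and ne: "V ` {\<pi>. \<pi> permutes {1..n}} \<noteq> {}"
    by (auto simp: finite_permutations intro: permutes_id)
  \<comment> \<open>There are finitely many orderings, so the maximum is attained even if some
    values are infinite.\<close>
  obtain \<rho> where \<rho>: "\<rho> permutes {1..n}" and max: "\<And>\<pi>. \<pi> permutes {1..n} \<Longrightarrow> V \<pi> \<le> V \<rho>"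
    using Max_in[OF fin ne] Max_ge[OF fin] by fastforce
  define M where "M = outcome n F \<rho> (OPTOn \<rho>)"
  have "\<forall>\<pi>. \<exists>A. \<pi> permutes {1..n} \<longrightarrow>
      (\<forall>i\<in>{1..n}. \<forall>x. joint_prob (outcome n F \<pi> A) i x = joint_prob M i x / 2)"
    using halving_rule unfolding M_def by blast
  then obtain OnTIF where half: "\<And>\<pi> i x. \<pi> permutes {1..n} \<Longrightarrow> i \<in> {1..n} \<Longrightarrow>
      joint_prob (outcome n F \<pi> (OnTIF \<pi>)) i x = joint_prob M i x / 2"
    by metis
  have "TIF n F OnTIF"
    unfolding TIF_def
  \<comment> \<open>Where \<open>pmf (F i) x = 0\<close> this witness is 0, so it lies in the unit
    interval everywhere.\<close>
  proof (intro exI[of _ "\<lambda>i x. joint_prob M i x / 2 / pmf (F i) x"] conjI ballI allI impI)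
    fix i x assume i: "i \<in> {1..n}"
    have "joint_prob M i x / 2 \<le> pmf (F i) x"
      using joint_prob_le[OF i, of F \<rho> "OPTOn \<rho>" x] joint_prob_nonneg[of M i x]
      unfolding M_def by linarith
    then show "joint_prob M i x / 2 / pmf (F i) x \<in> {0..1}"
      by (auto simp: divide_le_eq_1 pmf_nonneg less_le)
  qed (simp add: cond_prob_outcome half)
  moreover have "1 / 2 * V \<pi> \<le> expected_value n F \<pi> (OnTIF \<pi>)" if \<pi>: "\<pi> permutes {1..n}" for \<pi>
  proof -
    have "1 / 2 * V \<pi> \<le> 1 / 2 * V \<rho>"
      using max[OF \<pi>] by (rule mult_left_mono) simp
    also have "\<dots> = (\<Sum>i\<in>{1..n}. \<integral>\<^sup>+x. 1 / 2 * (ennreal x * ennreal (joint_prob M i x)) \<partial>count_space UNIV)"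
      by (simp add: V_def expected_value_joint_prob[OF \<rho>] M_def sum_distrib_left nn_integral_cmult)
    also have "\<dots> = expected_value n F \<pi> (OnTIF \<pi>)"
      unfolding expected_value_joint_prob[OF \<pi>]
    proof (intro sum.cong nn_integral_cong refl)
      fix i x assume "i \<in> {1..n}"
      then have "ennreal (joint_prob (outcome n F \<pi> (OnTIF \<pi>)) i x) = 1 / 2 * ennreal (joint_prob M i x)"
        by (subst mult.commute)
          (simp add: half[OF \<pi>] ennreal_times_divide ennreal_divide_numeral)
      then show "1 / 2 * (ennreal x * ennreal (joint_prob M i x)) =
          ennreal x * ennreal (joint_prob (outcome n F \<pi> (OnTIF \<pi>)) i x)"
        by (simp add: mult_ac)
    qed
    finally show ?thesis .
  qed
  ultimately show ?thesis
    unfolding V_def by blast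
qed

section \<open>Tightness: a two-candidate instance\<close>

definition tight_instance :: "real \<Rightarrow> nat \<Rightarrow> real pmf" where
  "tight_instance e i =
     (if i = 1 then return_pmf 1 else map_pmf (\<lambda>b. if b then 1 / e else 0) (bernoulli_pmf e))"

text \<open>Candidate 1 is deterministic, so two profiles remain. In the second,
  \<open>X 2 = 0\<close> coincides with the default value, hence no update at 2.\<close>

lemma nn_integral_tight_instance:
  fixes f :: "(nat \<Rightarrow> real) \<Rightarrow> ennreal"
  assumes "0 < e" "e < 1"
  shows "(\<integral>\<^sup>+X. f X \<partial>measure_pmf (Pi_pmf {1..2} 0 (tight_instance e))) =
    f ((\<lambda>_. 0)(1 := 1, 2 := 1 / e)) * ennreal e + f ((\<lambda>_. 0)(1 := 1)) * ennreal (1 - e)"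
proof -
  have "{1..2::nat} = {1, 2}" by auto
  moreover have "(\<lambda>_. 0)(Suc 0 := 1, 2 := 0) = (\<lambda>_::nat. 0::real)(Suc 0 := 1)" by auto
  ultimately show ?thesis
    using assms
    by (simp add: Pi_pmf_insert' tight_instance_def bind_return_pmf bind_map_pmf bind_assoc_pmf
        fun_upd_twist)
qed

text \<open>The first value is always 1 and carries no information; hiring it yields 1, and
  rejecting it leaves at most the mean of \<open>X 2\<close>, which is also 1.\<close>

lemma expected_value_tight_le_1:
  assumes "0 < e" "e < 1"
  shows "expected_value 2 (tight_instance e) id A \<le> 1"
proof -
  let ?P = "Pi_pmf {1..2} 0 (tight_instance e)"
  have X1: "X 1 = 1" if "X \<in> set_pmf ?P" for X
  proof -
    have "X 1 \<in> set_pmf (tight_instance e 1)"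
      using that unfolding set_Pi_pmf[OF finite_atLeastAtMost] PiE_dflt_def by force
    then show ?thesis by (simp add: tight_instance_def)
  qed
  define v :: "(nat \<Rightarrow> real) \<Rightarrow> nat option \<Rightarrow> ennreal" where "v = (\<lambda>X h. ennreal (hired_value (X, h)))"
  have l: "map id [1..<Suc 2] = [1, 2]"
    by (simp add: upt_conv_Cons numeral_2_eq_2)
  have "expected_value 2 (tight_instance e) id A =
      (\<integral>\<^sup>+X. \<integral>\<^sup>+h. v X h \<partial>hire_from A X [] 0 [1, 2] \<partial>?P)"
    unfolding expected_value_def outcome_def v_def l by simp
  \<comment> \<open>The first decision has law \<open>A [1] 0\<close> for every profile, so it is
    independent of \<open>X 2\<close>.\<close>
  also have "\<dots> = (\<integral>\<^sup>+X. \<integral>\<^sup>+(b, m). (if b then 1 else \<integral>\<^sup>+h. v X h \<partial>hire_from A X [1] m [2]) \<partial>A [1] 0 \<partial>?P)"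
  proof (intro nn_integral_cong_AE AE_pmfI)
    fix X assume "X \<in> set_pmf ?P"
    note X1 = X1[OF this]
    then have "(\<integral>\<^sup>+h. v X h \<partial>hire_from A X [] 0 [1, 2]) =
        (\<integral>\<^sup>+y. \<integral>\<^sup>+h. v X h \<partial>(case y of (b, m) \<Rightarrow>
           if b then return_pmf (Some 1) else hire_from A X [1] m [2]) \<partial>A [1] 0)"
      by (simp add: case_prod_unfold cong: if_cong)
    also have "\<dots> = (\<integral>\<^sup>+(b, m). (if b then 1 else \<integral>\<^sup>+h. v X h \<partial>hire_from A X [1] m [2]) \<partial>A [1] 0)"
      using X1 by (intro nn_integral_cong) (auto simp: v_def hired_value_def split: prod.splits)
    finally show "(\<integral>\<^sup>+h. v X h \<partial>hire_from A X [] 0 [1, 2]) = \<dots>" .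
  qed
  also have "\<dots> \<le> (\<integral>\<^sup>+X. \<integral>\<^sup>+(b, m). (if b then 1 else ennreal (X 2)) \<partial>A [1] 0 \<partial>?P)"
  proof -
    have "(\<integral>\<^sup>+h. v X h \<partial>hire_from A X [1] m [2]) \<le> ennreal (X 2)" for X m
    proof -
      have "(\<integral>\<^sup>+h. v X h \<partial>hire_from A X [1] m [2]) \<le> (\<integral>\<^sup>+h. ennreal (X 2) \<partial>hire_from A X [1] m [2])"
        using set_hire_from[of A X "[1]" m "[2]"]
        by (intro nn_integral_mono_AE AE_pmfI) (auto simp: v_def hired_value_def)
      then show ?thesis by simp
    qed
    then show ?thesis by (intro nn_integral_mono) (auto split: prod.splits)
  qed
  \<comment> \<open>That independence permits exchanging the integrals; the one over profiles is a
    two-term sum.\<close>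
  also have "\<dots> = (\<integral>\<^sup>+(b, m). \<integral>\<^sup>+X. (if b then 1 else ennreal (X 2)) \<partial>?P \<partial>A [1] 0)"
    unfolding nn_integral_tight_instance[OF assms]
    by (simp add: case_prod_unfold nn_integral_add nn_integral_multc)
  also have "\<dots> \<le> (\<integral>\<^sup>+y. 1 \<partial>A [1] 0)"
  proof (intro nn_integral_mono)
    fix y
    have "(\<integral>\<^sup>+X. (if b then 1 else ennreal (X 2)) \<partial>?P) = 1" for b
      using assms unfolding nn_integral_tight_instance[OF assms]
      by (simp flip: ennreal_plus ennreal_mult)
    then show "(case y of (b, m) \<Rightarrow> \<integral>\<^sup>+X. (if b then 1 else ennreal (X 2)) \<partial>?P) \<le> 1"
      by (simp add: case_prod_unfold)
  qed
  finally show ?thesis by simp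
qed

lemma swapped_ordering: "map (Transposition.transpose 1 2) [1..<Suc 2] = [2, 1::nat]"
  by (simp add: upt_conv_Cons numeral_2_eq_2)

text \<open>Only a first value 0 is rejected: at the second step the list has two entries and
  differs from \<open>[0]\<close>. In the order 2, 1 this hires the maximum.\<close>

definition greedy_rule :: stopping_rule where
  "greedy_rule xs m = return_pmf (xs \<noteq> [0], 0)"

text \<open>No rule beats the maximum of the two values, whose mean is
  \<open>e * (1 / e) + (1 - e)\<close>, and the greedy rule attains it.\<close>

lemma expected_value_greedy_rule:
  assumes "0 < e" "e < 1"
  shows "expected_value 2 (tight_instance e) (Transposition.transpose 1 2) greedy_rule = ennreal (2 - e)"
    and "optimal_rule 2 (tight_instance e) (Transposition.transpose 1 2) greedy_rule"
proof -
  let ?P = "Pi_pmf {1..2} 0 (tight_instance e)"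
  have ev: "expected_value 2 (tight_instance e) (Transposition.transpose 1 2) A =
      (\<integral>\<^sup>+X. \<integral>\<^sup>+h. ennreal (hired_value (X, h)) \<partial>hire_from A X [] 0 [2, 1] \<partial>?P)" for A
    unfolding expected_value_def outcome_def swapped_ordering by simp
  have plus: "1 + ennreal (1 - e) = ennreal (2 - e)"
    using assms ennreal_plus[of 1 "1 - e"] by simp
  have max: "(\<integral>\<^sup>+X. ennreal (max (X 1) (X 2)) \<partial>?P) = ennreal (2 - e)"
    using assms unfolding nn_integral_tight_instance[OF assms]
    by (simp add: max_def plus flip: ennreal_mult)
  show greedy: "expected_value 2 (tight_instance e) (Transposition.transpose 1 2) greedy_rule = ennreal (2 - e)"
    using assms unfolding ev nn_integral_tight_instance[OF assms]
    by (simp add: greedy_rule_def bind_return_pmf hired_value_def plus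
        flip: ennreal_mult)
  have "expected_value 2 (tight_instance e) (Transposition.transpose 1 2) A \<le> ennreal (2 - e)" for A
  proof -
    have "expected_value 2 (tight_instance e) (Transposition.transpose 1 2) A \<le>
        (\<integral>\<^sup>+X. \<integral>\<^sup>+h. ennreal (max (X 1) (X 2)) \<partial>hire_from A X [] 0 [2, 1] \<partial>?P)"
      unfolding ev
    proof (rule nn_integral_mono, rule nn_integral_mono_AE, rule AE_pmfI)
      fix X h assume "h \<in> set_pmf (hire_from A X [] 0 [2, 1])"
      then have "h \<in> {None, Some 1, Some 2}"
        using set_hire_from[of A X "[]" 0 "[2, 1]"] by auto
      then show "ennreal (hired_value (X, h)) \<le> ennreal (max (X 1) (X 2))"
        by (auto simp: hired_value_def intro: ennreal_leI)
    qed
    then show ?thesis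
      by (simp only: nn_integral_const measure_pmf.emeasure_space_1 max mult_1_right)
  qed
  then show "optimal_rule 2 (tight_instance e) (Transposition.transpose 1 2) greedy_rule"
    unfolding optimal_rule_def greedy by blast
qed

lemma half_TIF_tight:
  assumes "c > 1 / 2"
  shows "\<exists>(n :: nat) (F :: nat \<Rightarrow> real pmf) (\<pi> :: nat \<Rightarrow> nat) (OPTOn :: stopping_rule).
           hiring_instance n F \<and> \<pi> permutes {1..n} \<and> optimal_rule n F \<pi> OPTOn \<and>
           (\<forall>ALG :: (nat \<Rightarrow> nat) \<Rightarrow> stopping_rule. TIF n F ALG \<longrightarrow>
              expected_value n F \<pi> (ALG \<pi>) < ennreal c * expected_value n F \<pi> OPTOn)"
proof -
  \<comment> \<open>With this choice \<open>c * (2 - e) = c + 1 / 2\<close>, which exceeds 1 exactly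
    when \<open>c > 1 / 2\<close>.\<close>
  define e where "e = 1 - 1 / (2 * c)"
  have e: "0 < e" "e < 1" and gap: "1 < c * (2 - e)"
    using assms by (auto simp: e_def field_simps)
  let ?F = "tight_instance e" and ?\<pi> = "Transposition.transpose 1 2 :: nat \<Rightarrow> nat"
  have "hiring_instance 2 ?F"
    using e by (auto simp: hiring_instance_def tight_instance_def)
  moreover have \<pi>: "?\<pi> permutes {1..2}"
    by (intro permutes_swap_id) auto
  moreover have "expected_value 2 ?F ?\<pi> (ALG ?\<pi>) < ennreal c * expected_value 2 ?F ?\<pi> greedy_rule"
    if "TIF 2 ?F ALG" for ALG
  proof -
    \<comment> \<open>TIF transfers the bound from the unfavourable order 1, 2 to the order 2,
      1.\<close>
    have "expected_value 2 ?F ?\<pi> (ALG ?\<pi>) = expected_value 2 ?F id (ALG id)"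
      using that \<pi> permutes_id by (rule TIF_expected_value_eq)
    also have "\<dots> \<le> 1"
      using e by (rule expected_value_tight_le_1)
    also have "1 < ennreal (c * (2 - e))"
      using gap by simp
    also have "\<dots> = ennreal c * expected_value 2 ?F ?\<pi> greedy_rule"
      unfolding expected_value_greedy_rule(1)[OF e] using assms e by (simp add: ennreal_mult)
    finally show ?thesis .
  qed
  ultimately show ?thesis
    using expected_value_greedy_rule(2)[OF e] by blast
qed

theorem mainTheorem14:
  shows "(\<forall>(n :: nat) (F :: nat \<Rightarrow> real pmf) (OPTOn :: (nat \<Rightarrow> nat) \<Rightarrow> stopping_rule).
            hiring_instance n F \<longrightarrow>
            (\<forall>\<pi>. \<pi> permutes {1..n} \<longrightarrow> optimal_rule n F \<pi> (OPTOn \<pi>)) \<longrightarrow>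
            (\<exists>OnTIF :: (nat \<Rightarrow> nat) \<Rightarrow> stopping_rule.
               TIF n F OnTIF \<and>
               (\<forall>\<pi>. \<pi> permutes {1..n} \<longrightarrow>
                  expected_value n F \<pi> (OnTIF \<pi>) \<ge> 1 / 2 * expected_value n F \<pi> (OPTOn \<pi>))))
       \<and> (\<forall>c :: real. c > 1 / 2 \<longrightarrow>
            (\<exists>(n :: nat) (F :: nat \<Rightarrow> real pmf) (\<pi> :: nat \<Rightarrow> nat) (OPTOn :: stopping_rule).
               hiring_instance n F \<and> \<pi> permutes {1..n} \<and> optimal_rule n F \<pi> OPTOn \<and>
               (\<forall>ALG :: (nat \<Rightarrow> nat) \<Rightarrow> stopping_rule. TIF n F ALG \<longrightarrow>
                  expected_value n F \<pi> (ALG \<pi>) < ennreal c * expected_value n F \<pi> OPTOn)))"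
  by (intro conjI allI impI half_TIF_family half_TIF_tight)

end
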